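(* Let $f$ and $g$ be multi-valued functions on represented spaces. Then (1) $f\leq_{\mathrm W}\widehat{f}$; (2) if $f\leq_{\mathrm W}g$ then $\widehat{f}\leq_{\mathrm W}\widehat{g}$; (3) $\widehat{f}\equiv_{\mathrm W}\widehat{\widehat{f}}$. The analogous three statements hold with strong Weihrauch reducibility $\leq_{\mathrm{sW}}$ (and $\equiv_{\mathrm{sW}}$) in place of $\leq_{\mathrm W}$ (and $\equiv_{\mathrm W}$).
   Context: A represented space $(X,\delta_X)$ is a set $X$ with a surjective partial map $\delta_X:\subseteq\mathbb{N}^{\mathbb{N}}\to X$. A multi-valued function $f:\subseteq X\rightrightarrows Y$ assigns to each $x$ a set $f(x)\subseteq Y$, with $\mathrm{dom}(f)=\{x: f(x)\neq\emptyset\}$. A realizer of $f$ is a partial function $F:\subseteq\mathbb{N}^{\mathbb{N}}\to\mathbb{N}^{\mathbb{N}}$ such that $F(p)$ is defined and $\delta_YF(p)\in f(\delta_X(p))$ for all $p$ with $\delta_X(p)\in\mathrm{dom}(f)$. Let $\langle\cdot,\cdot\rangle$ be a computable standard pairing function on $\mathbb{N}^{\mathbb{N}}$, and $\langle p_0,p_1,p_2,\dots\rangle\in\mathbb{N}^{\mathbb{N}}$ the computable tupling of a sequence, $\langle p_0,p_1,\dots\rangle\langle n,k\rangle=p_n(k)$. $f\leq_{\mathrm W}g$ iff there are computable $H,K:\subseteq\mathbb{N}^{\mathbb{N}}\to\mathbb{N}^{\mathbb{N}}$ such that for every realizer $G$ of $g$ the function $p\mapsto H\langle p,GK(p)\rangle$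 is a realizer of $f$. $f\leq_{\mathrm{sW}}g$ is defined in the same way with $HGK$ in place of $p\mapsto H\langle p,GK(p)\rangle$. $\equiv_{\mathrm W},\equiv_{\mathrm{sW}}$ are the induced equivalence relations. Parallelization: for $f:\subseteq X\rightrightarrows Y$, $\widehat{f}:\subseteq X^{\mathbb{N}}\rightrightarrows Y^{\mathbb{N}}$ is defined by $\widehat{f}((x_i)_{i\in\mathbb{N}})=\prod_{i=0}^\infty f(x_i)$ (defined exactly when all $x_i\in\mathrm{dom}(f)$). $X^{\mathbb{N}}$ carries the representation $\delta_X^{\mathbb{N}}\langle p_0,p_1,p_2,\dots\rangle=(\delta_X(p_i))_{i\in\mathbb{N}}$. *)

theory Defs
  imports Main "HOL-Library.Nat_Bijection"
begin

section \<open>Computable partial functions on Baire space\<close>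

type_synonym baire = "nat \<Rightarrow> nat"

text \<open>Unbounded search. It is undefined if some value below the first zero is undefined.\<close>

definition minimize :: "(nat \<Rightarrow> nat option) \<Rightarrow> nat option" where
  "minimize \<phi> =
     (if \<exists>y. \<phi> y = Some 0 \<and> (\<forall>z<y. \<exists>v. \<phi> z = Some (Suc v))
      then Some (LEAST y. \<phi> y = Some 0) else None)"

text \<open>
  \<open>recursive_in k \<Phi>\<close>: the \<open>k\<close>-ary partial function \<open>\<Phi> p\<close> is partial recursive in \<open>p\<close>,
  uniformly in \<open>p\<close> (Kleene's schemes together with access to the values of \<open>p\<close>).
  The argument tuple is a list, and only lists of length \<open>k\<close> are meaningful; on such lists none
  of the schemes below consults \<open>hd []\<close>, \<open>tl []\<close> or an index that is out of range.
\<close>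

inductive recursive_in :: "nat \<Rightarrow> (baire \<Rightarrow> nat list \<Rightarrow> nat option) \<Rightarrow> bool" where
  zero: "recursive_in k (\<lambda>p xs. Some 0)"
| succ: "recursive_in 1 (\<lambda>p xs. Some (Suc (hd xs)))"
| proj: "i < k \<Longrightarrow> recursive_in k (\<lambda>p xs. Some (xs ! i))"
| query: "recursive_in 1 (\<lambda>p xs. Some (p (hd xs)))"
| comp: "recursive_in (length \<Psi>s) \<Phi> \<Longrightarrow> (\<forall>\<Psi>\<in>set \<Psi>s. recursive_in k \<Psi>) \<Longrightarrow>
    recursive_in k (\<lambda>p xs. Option.bind (those (map (\<lambda>\<Psi>. \<Psi> p xs) \<Psi>s)) (\<Phi> p))"
| prim: "recursive_in k \<Phi> \<Longrightarrow> recursive_in (k + 2) \<Psi> \<Longrightarrow>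
    recursive_in (k + 1) (\<lambda>p xs. rec_nat (\<Phi> p (tl xs))
      (\<lambda>n r. Option.bind r (\<lambda>y. \<Psi> p (n # y # tl xs))) (hd xs))"
| mu: "recursive_in (k + 1) \<Phi> \<Longrightarrow> recursive_in k (\<lambda>p xs. minimize (\<lambda>y. \<Phi> p (y # xs)))"

text \<open>
  As is usual for computability on Baire space, an algorithm for \<open>F\<close> has to compute
  \<open>F p\<close> for \<open>p\<close> in the domain of \<open>F\<close> and may behave arbitrarily on other inputs.
\<close>

definition computable :: "(baire \<rightharpoonup> baire) \<Rightarrow> bool" where
  "computable F \<longleftrightarrow>
     (\<exists>\<Phi>. recursive_in 1 \<Phi> \<and> (\<forall>p q. F p = Some q \<longrightarrow> (\<forall>n. \<Phi> p [n] = Some (q n))))"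

definition pair :: "baire \<Rightarrow> baire \<Rightarrow> baire" where
  "pair p q = (\<lambda>n. if even n then p (n div 2) else q (n div 2))"

definition tuple :: "(nat \<Rightarrow> baire) \<Rightarrow> baire" where
  "tuple ps = (\<lambda>m. case prod_decode m of (n, k) \<Rightarrow> ps n k)"

text \<open>
  As \<^const>\<open>prod_encode\<close> is a bijection, every \<open>p\<close> is the tupling of exactly one
  sequence, namely \<open>component p\<close>; this is used below to invert the tupling.
\<close>

definition component :: "baire \<Rightarrow> nat \<Rightarrow> baire" where
  "component p n = (\<lambda>k. p (prod_encode (n, k)))"

lemma tuple_prod_encode: "tuple ps (prod_encode (n, k)) = ps n k"
  by (simp add: tuple_def)

lemma component_tuple [simp]: "component (tuple ps) n = ps n"
  by (simp add: component_def tuple_def)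

lemma tuple_component [simp]: "tuple (component p) = p"
proof
  fix m show "tuple (component p) m = p m"
    by (cases "prod_decode m") (metis component_def tuple_prod_encode prod_decode_inverse)
qed


section \<open>Represented spaces and multi-valued functions\<close>

record 'a repspace =
  points :: "'a set"
  rep :: "baire \<rightharpoonup> 'a"

definition represented_space :: "'a repspace \<Rightarrow> bool" where
  "represented_space X \<longleftrightarrow> ran (rep X) = points X"

record ('a, 'b) mvfun =
  source :: "'a repspace"
  target :: "'b repspace"
  vals :: "'a \<Rightarrow> 'b set"

definition multivalued_function :: "('a, 'b) mvfun \<Rightarrow> bool" where
  "multivalued_function f \<longleftrightarrow>
     represented_space (source f) \<and> represented_space (target f) \<and>
     (\<forall>x\<in>points (source f). vals f x \<subseteq> points (target f)) \<and>
     (\<forall>x. x \<notin> points (source f) \<longrightarrow> vals f x = {})"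

definition mv_dom :: "('a, 'b) mvfun \<Rightarrow> 'a set" where
  "mv_dom f = {x \<in> points (source f). vals f x \<noteq> {}}"

definition realizer :: "(baire \<rightharpoonup> baire) \<Rightarrow> ('a, 'b) mvfun \<Rightarrow> bool" where
  "realizer F f \<longleftrightarrow>
     (\<forall>p x. rep (source f) p = Some x \<and> x \<in> mv_dom f \<longrightarrow>
        (\<exists>q y. F p = Some q \<and> rep (target f) q = Some y \<and> y \<in> vals f x))"


section \<open>Weihrauch reducibility\<close>

definition weihrauch_le :: "('a, 'b) mvfun \<Rightarrow> ('c, 'd) mvfun \<Rightarrow> bool"
    (infix "\<le>\<^sub>W" 50) where
  "f \<le>\<^sub>W g \<longleftrightarrow>
     (\<exists>H K. computable H \<and> computable K \<and>
        (\<forall>G. realizer G g \<longrightarrow>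
           realizer (\<lambda>p. Option.bind (Option.bind (K p) G) (\<lambda>q. H (pair p q))) f))"

definition strong_weihrauch_le :: "('a, 'b) mvfun \<Rightarrow> ('c, 'd) mvfun \<Rightarrow> bool"
    (infix "\<le>\<^sub>s\<^sub>W" 50) where
  "f \<le>\<^sub>s\<^sub>W g \<longleftrightarrow>
     (\<exists>H K. computable H \<and> computable K \<and>
        (\<forall>G. realizer G g \<longrightarrow> realizer (\<lambda>p. Option.bind (Option.bind (K p) G) H) f))"

definition weihrauch_equiv :: "('a, 'b) mvfun \<Rightarrow> ('c, 'd) mvfun \<Rightarrow> bool"
    (infix "\<equiv>\<^sub>W" 50) where
  "f \<equiv>\<^sub>W g \<longleftrightarrow> f \<le>\<^sub>W g \<and> g \<le>\<^sub>W f"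

definition strong_weihrauch_equiv :: "('a, 'b) mvfun \<Rightarrow> ('c, 'd) mvfun \<Rightarrow> bool"
    (infix "\<equiv>\<^sub>s\<^sub>W" 50) where
  "f \<equiv>\<^sub>s\<^sub>W g \<longleftrightarrow> f \<le>\<^sub>s\<^sub>W g \<and> g \<le>\<^sub>s\<^sub>W f"


section \<open>Parallelization\<close>

definition seq_space :: "'a repspace \<Rightarrow> (nat \<Rightarrow> 'a) repspace" where
  "seq_space X =
     \<lparr>points = {x. \<forall>i. x i \<in> points X},
      rep = (\<lambda>p. if \<forall>i. rep X (component p i) \<noteq> None
                 then Some (\<lambda>i. the (rep X (component p i))) else None)\<rparr>"

definition parallelization :: "('a, 'b) mvfun \<Rightarrow> (nat \<Rightarrow> 'a, nat \<Rightarrow> 'b) mvfun" where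
  "parallelization f =
     \<lparr>source = seq_space (source f), target = seq_space (target f),
      vals = (\<lambda>x. {y. \<forall>i. y i \<in> vals f (x i)})\<rparr>"

lemma rep_seq_space_iff:
  "rep (seq_space X) p = Some x \<longleftrightarrow> (\<forall>i. rep X (component p i) = Some (x i))"
proof
  assume "rep (seq_space X) p = Some x"
  then have "\<forall>i. rep X (component p i) \<noteq> None" "x = (\<lambda>i. the (rep X (component p i)))"
    by (simp_all add: seq_space_def split: if_splits)
  then show "\<forall>i. rep X (component p i) = Some (x i)" by simp
next
  assume "\<forall>i. rep X (component p i) = Some (x i)"
  then show "rep (seq_space X) p = Some x" by (simp add: seq_space_def)
qed

lemma rep_seq_space_tuple:
  "rep (seq_space X) (tuple ps) = Some x \<longleftrightarrow> (\<forall>i. rep X (ps i) = Some (x i))"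
  by (simp add: rep_seq_space_iff)

lemma represented_space_seq_space:
  assumes "represented_space X"
  shows "represented_space (seq_space X)"
proof -
  have *: "x \<in> points X \<longleftrightarrow> (\<exists>p. rep X p = Some x)" for x
    using assms unfolding represented_space_def ran_def by blast
  have "(\<exists>p. rep (seq_space X) p = Some x) \<longleftrightarrow> x \<in> points (seq_space X)" for x
  proof
    assume "\<exists>p. rep (seq_space X) p = Some x"
    then show "x \<in> points (seq_space X)"
      unfolding rep_seq_space_iff by (auto simp: seq_space_def *)
  next
    assume "x \<in> points (seq_space X)"
    then have "\<forall>i. \<exists>p. rep X p = Some (x i)"
      by (auto simp: seq_space_def *)
    then obtain ps where "\<forall>i. rep X (ps i) = Some (x i)"
      by metis
    then show "\<exists>p. rep (seq_space X) p = Some x"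
      using rep_seq_space_tuple by blast
  qed
  then show ?thesis
    unfolding represented_space_def ran_def by blast
qed

lemma multivalued_function_parallelization:
  assumes "multivalued_function f"
  shows "multivalued_function (parallelization f)"
proof -
  have sub: "vals f x \<subseteq> points (target f)" for x
    using assms unfolding multivalued_function_def by (cases "x \<in> points (source f)") auto
  have empty: "vals f x = {}" if "x \<notin> points (source f)" for x
    using assms that unfolding multivalued_function_def by blast
  show ?thesis
    unfolding multivalued_function_def
  proof (intro conjI ballI allI impI)
    show "represented_space (source (parallelization f))"
      "represented_space (target (parallelization f))"
      using assms by (simp_all add: parallelization_def represented_space_seq_space
          multivalued_function_def)
    show "vals (parallelization f) x \<subseteq> points (target (parallelization f))" for x
      using sub unfolding parallelization_def seq_space_def by auto
    show "vals (parallelization f) x = {}"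
      if x: "x \<notin> points (source (parallelization f))" for x
    proof -
      obtain i where "x i \<notin> points (source f)"
        using x unfolding parallelization_def seq_space_def by auto
      then have "vals f (x i) = {}" by (rule empty)
      then show ?thesis unfolding parallelization_def by auto
    qed
  qed
qed

lemma mv_dom_parallelization:
  "mv_dom (parallelization f) = {x. \<forall>i. x i \<in> mv_dom f}"
proof -
  have "(\<exists>y. \<forall>i. y i \<in> vals f (x i)) \<longleftrightarrow> (\<forall>i. vals f (x i) \<noteq> {})" for x
    using choice[of "\<lambda>i z. z \<in> vals f (x i)"] by blast
  then show ?thesis
    unfolding mv_dom_def parallelization_def seq_space_def by simp blast
qed

end

theory Submission imports Defs begin

text \<open>
  Most of these reductions come from one kind of map on Baire space: composing the input with a
  fixed recursive map on the natural numbers. Repeating a name, extracting a component of a tuple and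
  regrouping a sequence of sequences along \<^const>\<open>prod_encode\<close> are of this form. They
  show that parallelization is extensive and idempotent for strong reducibility, and that strong
  reducibility implies ordinary reducibility.

  For monotonicity, let \<open>H\<close> and \<open>K\<close> witness that \<open>f\<close> reduces to \<open>g\<close>. The parallelizations are reduced by
  applying \<open>K\<close>, and later \<open>H\<close>, in each component. This is computable because an algorithm for \<open>F\<close>
  can be run with an oracle that depends on a number \<open>i\<close> given as an additional argument
  (\<open>recursive_on_parameterized_oracle\<close>), which yields all components of the result uniformly in
  \<open>i\<close> (\<open>computable_componentwise\<close>). That the result is correct is not immediate, since \<open>H\<close> and
  \<open>K\<close> are only known to work for a realizer \<open>G\<close> of \<open>g\<close> as a whole, whereas a realizer of the
  parallelization of \<open>g\<close> may answer the same question differently in different components or in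
  different sequences. A realizer of \<open>g\<close>, however, may be undefined outside the names of points in
  the domain, and its values at names can be chosen independently of each other. Hence \<open>K\<close> must send
  a name of a point in the domain of \<open>f\<close> to a name of a point in the domain of \<open>g\<close>, and \<open>H\<close> must cope
  with each single correct answer (\<open>reduces_via_pointwise\<close>); in this pointwise form reducibility
  clearly passes to sequences.
\<close>

section \<open>Recursive functions on tuples of fixed length\<close>

text \<open>
  On lists of the wrong length, the value of a function with
  \<^const>\<open>recursive_in\<close> depends on how it was built from the schemes. Only the values on
  tuples of length \<open>k\<close> are prescribed here, so that functions can be given by convenient terms.
\<close>

definition recursive_on :: "nat \<Rightarrow> (baire \<Rightarrow> nat list \<Rightarrow> nat option) \<Rightarrow> bool" where
  "recursive_on k \<Phi> \<longleftrightarrow>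
     (\<exists>\<Phi>'. recursive_in k \<Phi>' \<and> (\<forall>p xs. length xs = k \<longrightarrow> \<Phi>' p xs = \<Phi> p xs))"

abbreviation total_recursive_on :: "nat \<Rightarrow> (baire \<Rightarrow> nat list \<Rightarrow> nat) \<Rightarrow> bool" where
  "total_recursive_on k h \<equiv> recursive_on k (\<lambda>p xs. Some (h p xs))"

lemma recursive_in_imp_recursive_on: "recursive_in k \<Phi> \<Longrightarrow> recursive_on k \<Phi>"
  unfolding recursive_on_def by blast

lemma recursive_on_cong:
  assumes "recursive_on k \<Phi>" and "\<And>p xs. length xs = k \<Longrightarrow> \<Phi> p xs = \<Psi> p xs"
  shows "recursive_on k \<Psi>"
  using assms unfolding recursive_on_def by metis

lemma length_those: "those xs = Some ys \<Longrightarrow> length ys = length xs"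
  by (induction xs arbitrary: ys) (auto split: option.splits)

lemma those_map_Some: "those (map (\<lambda>x. Some (f x)) xs) = Some (map f xs)"
  by (induction xs) auto

lemma those_snoc_Some:
  "those (xs @ [Some y]) = map_option (\<lambda>ys. ys @ [y]) (those xs)"
  by (induction xs) (auto split: option.splits simp: option.map_comp comp_def)

lemma recursive_on_comp:
  assumes \<Phi>: "recursive_on (length \<Psi>s) \<Phi>" and \<Psi>s: "\<forall>\<Psi>\<in>set \<Psi>s. recursive_on k \<Psi>"
  shows "recursive_on k (\<lambda>p xs. Option.bind (those (map (\<lambda>\<Psi>. \<Psi> p xs) \<Psi>s)) (\<Phi> p))"
proof -
  obtain \<Phi>' where \<Phi>': "recursive_in (length \<Psi>s) \<Phi>'"
    "\<And>p xs. length xs = length \<Psi>s \<Longrightarrow> \<Phi>' p xs = \<Phi> p xs"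
    using \<Phi> unfolding recursive_on_def by blast
  obtain C where C: "\<And>\<Psi>. \<Psi> \<in> set \<Psi>s \<Longrightarrow> recursive_in k (C \<Psi>)"
    "\<And>\<Psi> p xs. \<Psi> \<in> set \<Psi>s \<Longrightarrow> length xs = k \<Longrightarrow> C \<Psi> p xs = \<Psi> p xs"
    using \<Psi>s unfolding recursive_on_def by metis
  have "recursive_in k
      (\<lambda>p xs. Option.bind (those (map (\<lambda>\<Psi>. \<Psi> p xs) (map C \<Psi>s))) (\<Phi>' p))"
    by (rule recursive_in.comp) (simp_all add: \<Phi>'(1) C(1))
  moreover have "Option.bind (those (map (\<lambda>\<Psi>. \<Psi> p xs) (map C \<Psi>s))) (\<Phi>' p) =
      Option.bind (those (map (\<lambda>\<Psi>. \<Psi> p xs) \<Psi>s)) (\<Phi> p)" if "length xs = k" for p xs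
  proof -
    have eq: "map (\<lambda>\<Psi>. \<Psi> p xs) (map C \<Psi>s) = map (\<lambda>\<Psi>. \<Psi> p xs) \<Psi>s"
      using C(2)[OF _ that] by simp
    show ?thesis
      unfolding eq
      by (cases "those (map (\<lambda>\<Psi>. \<Psi> p xs) \<Psi>s)") (simp_all add: \<Phi>'(2) length_those)
  qed
  ultimately show ?thesis
    unfolding recursive_on_def by blast
qed

lemma recursive_on_prim:
  assumes "recursive_on k \<Phi>" and "recursive_on (k + 2) \<Psi>"
  shows "recursive_on (k + 1) (\<lambda>p xs. rec_nat (\<Phi> p (tl xs))
      (\<lambda>n r. Option.bind r (\<lambda>y. \<Psi> p (n # y # tl xs))) (hd xs))"
proof -
  obtain \<Phi>' \<Psi>' where \<Phi>': "recursive_in k \<Phi>'"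
    "\<And>p xs. length xs = k \<Longrightarrow> \<Phi>' p xs = \<Phi> p xs"
    and \<Psi>': "recursive_in (k + 2) \<Psi>'"
    "\<And>p xs. length xs = k + 2 \<Longrightarrow> \<Psi>' p xs = \<Psi> p xs"
    using assms unfolding recursive_on_def by blast
  have "rec_nat (\<Phi>' p (tl xs)) (\<lambda>n r. Option.bind r (\<lambda>y. \<Psi>' p (n # y # tl xs))) (hd xs) =
      rec_nat (\<Phi> p (tl xs)) (\<lambda>n r. Option.bind r (\<lambda>y. \<Psi> p (n # y # tl xs))) (hd xs)"
    if "length xs = k + 1" for p xs
    using that by (simp add: \<Phi>'(2) \<Psi>'(2))
  with recursive_in.prim[OF \<Phi>'(1) \<Psi>'(1)] show ?thesis
    unfolding recursive_on_def by blast
qed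

lemma recursive_on_mu:
  assumes "recursive_on (k + 1) \<Phi>"
  shows "recursive_on k (\<lambda>p xs. minimize (\<lambda>y. \<Phi> p (y # xs)))"
proof -
  obtain \<Phi>' where \<Phi>': "recursive_in (k + 1) \<Phi>'"
    "\<And>p xs. length xs = k + 1 \<Longrightarrow> \<Phi>' p xs = \<Phi> p xs"
    using assms unfolding recursive_on_def by blast
  have "minimize (\<lambda>y. \<Phi>' p (y # xs)) = minimize (\<lambda>y. \<Phi> p (y # xs))"
    if "length xs = k" for p xs
    using that by (simp add: \<Phi>'(2))
  with recursive_in.mu[OF \<Phi>'(1)] show ?thesis
    unfolding recursive_on_def by blast
qed

lemma recursive_on_comp_total:
  assumes "recursive_on (length hs) \<Phi>" and "\<forall>h\<in>set hs. total_recursive_on k h"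
  shows "recursive_on k (\<lambda>p xs. \<Phi> p (map (\<lambda>h. h p xs) hs))"
  using recursive_on_comp[of "map (\<lambda>h p xs. Some (h p xs)) hs" \<Phi> k] assms
  by (simp add: comp_def those_map_Some)

lemma recursive_on_comp1:
  assumes "recursive_on 1 \<Phi>" and "total_recursive_on k a"
  shows "recursive_on k (\<lambda>p xs. \<Phi> p [a p xs])"
  using recursive_on_comp_total[of "[a]" \<Phi> k] assms by simp

lemma recursive_on_comp2:
  assumes "recursive_on 2 \<Phi>" and "total_recursive_on k a" and "total_recursive_on k b"
  shows "recursive_on k (\<lambda>p xs. \<Phi> p [a p xs, b p xs])"
  using recursive_on_comp_total[of "[a, b]" \<Phi> k] assms by (simp add: numeral_2_eq_2)

lemma total_recursive_on_nth: "i < k \<Longrightarrow> total_recursive_on k (\<lambda>p xs. xs ! i)"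
  by (intro recursive_in_imp_recursive_on recursive_in.proj)

lemma total_recursive_on_Suc:
  assumes "total_recursive_on k a"
  shows "total_recursive_on k (\<lambda>p xs. Suc (a p xs))"
  using recursive_on_comp1[OF recursive_in_imp_recursive_on[OF recursive_in.succ] assms] by simp

lemma total_recursive_on_query:
  assumes "total_recursive_on k a"
  shows "total_recursive_on k (\<lambda>p xs. p (a p xs))"
  using recursive_on_comp1[OF recursive_in_imp_recursive_on[OF recursive_in.query] assms] by simp

lemma total_recursive_on_const: "total_recursive_on k (\<lambda>p xs. c)"
proof (induction c)
  case 0
  show ?case by (intro recursive_in_imp_recursive_on recursive_in.zero)
next
  case (Suc c)
  then show ?case by (rule total_recursive_on_Suc)
qed

text \<open>
  Primitive recursion with a computed bound, in which step and start refer to the same tuple \<open>xs\<close>: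
  the scheme is composed with the bound and all \<open>k\<close> projections.
\<close>

lemma total_recursive_on_rec_nat:
  assumes n: "total_recursive_on k n" and a: "total_recursive_on k a"
    and b: "total_recursive_on (k + 2) (\<lambda>p ys. b p (ys ! 0) (ys ! 1) (drop 2 ys))"
  shows "total_recursive_on k (\<lambda>p xs. rec_nat (a p xs) (\<lambda>i r. b p i r xs) (n p xs))"
proof -
  have bind: "rec_nat (Some s) (\<lambda>i r. Option.bind r (\<lambda>y. Some (c i y))) m =
      Some (rec_nat s c m)" for s c m
    by (induction m) auto
  have "total_recursive_on (k + 1)
      (\<lambda>p ys. rec_nat (a p (tl ys)) (\<lambda>i r. b p i r (tl ys)) (hd ys))"
    using recursive_on_prim[OF a b] by (simp add: bind)
  then have "total_recursive_on k (\<lambda>p xs. (\<lambda>ys. rec_nat (a p (tl ys))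
      (\<lambda>i r. b p i r (tl ys)) (hd ys)) (map (\<lambda>h. h p xs) (n # map (\<lambda>i p xs. xs ! i) [0..<k])))"
    using n total_recursive_on_nth
    by (intro recursive_on_comp_total[where \<Phi> = "\<lambda>p ys. Some (rec_nat (a p (tl ys))
      (\<lambda>i r. b p i r (tl ys)) (hd ys))"]) auto
  then show ?thesis
    by (rule recursive_on_cong) (simp add: comp_def, metis map_nth)
qed

section \<open>Recursiveness of the pairing of numbers\<close>

lemma total_recursive_on_add:
  assumes "total_recursive_on k a" and "total_recursive_on k b"
  shows "total_recursive_on k (\<lambda>p xs. a p xs + b p xs)"
proof -
  have eq: "rec_nat m (\<lambda>i r. Suc r) n = n + m" for m n :: nat
    by (induction n) auto
  show ?thesis
    using total_recursive_on_rec_nat[OF assms, of "\<lambda>p i r xs. Suc r"]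
    by (simp add: eq total_recursive_on_Suc total_recursive_on_nth)
qed

lemma total_recursive_on_diff:
  assumes "total_recursive_on k a" and "total_recursive_on k b"
  shows "total_recursive_on k (\<lambda>p xs. a p xs - b p xs)"
proof -
  have pred: "rec_nat 0 (\<lambda>i r. i) n = n - 1" for n :: nat
    by (cases n) auto
  have pred_rec: "total_recursive_on l (\<lambda>p xs. c p xs - 1)" if "total_recursive_on l c" for l c
    using total_recursive_on_rec_nat[OF that total_recursive_on_const, of "\<lambda>p i r xs. i" 0]
    by (simp add: pred total_recursive_on_nth)
  have eq: "rec_nat m (\<lambda>i r. r - Suc 0) n = m - n" for m n :: nat
    by (induction n) auto
  show ?thesis
    using total_recursive_on_rec_nat[OF assms(2,1), of "\<lambda>p i r xs. r - 1"]
      pred_rec[OF total_recursive_on_nth[of 1 "k + 2"]]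
    by (simp add: eq)
qed

lemma total_recursive_on_mod2:
  assumes "total_recursive_on k a"
  shows "total_recursive_on k (\<lambda>p xs. a p xs mod 2)"
proof -
  have eq: "rec_nat 0 (\<lambda>i r. Suc 0 - r) n = n mod 2" for n :: nat
    by (induction n) (auto simp: mod_Suc)
  show ?thesis
    using total_recursive_on_rec_nat[OF assms total_recursive_on_const, of "\<lambda>p i r xs. 1 - r" 0]
      total_recursive_on_diff[OF total_recursive_on_const[of _ 1] total_recursive_on_nth[of 1 "k + 2"]]
    by (simp add: eq)
qed

lemma total_recursive_on_div2:
  assumes "total_recursive_on k a"
  shows "total_recursive_on k (\<lambda>p xs. a p xs div 2)"
proof -
  have eq: "rec_nat 0 (\<lambda>i r. r + i mod 2) n = n div 2" for n :: nat
    by (induction n) (auto, presburger)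
  show ?thesis
    using total_recursive_on_rec_nat[OF assms total_recursive_on_const, of "\<lambda>p i r xs. r + i mod 2" 0]
      total_recursive_on_add[OF total_recursive_on_nth[of 1 "k + 2"]
        total_recursive_on_mod2[OF total_recursive_on_nth[of 0 "k + 2"]]]
    by (simp add: eq)
qed

lemma total_recursive_on_triangle:
  assumes "total_recursive_on k a"
  shows "total_recursive_on k (\<lambda>p xs. triangle (a p xs))"
proof -
  have eq: "rec_nat 0 (\<lambda>i r. Suc (r + i)) n = triangle n" for n :: nat
    by (induction n) auto
  show ?thesis
    using total_recursive_on_rec_nat[OF assms total_recursive_on_const, of "\<lambda>p i r xs. r + Suc i" 0]
      total_recursive_on_add[OF total_recursive_on_nth[of 1 "k + 2"]
        total_recursive_on_Suc[OF total_recursive_on_nth[of 0 "k + 2"]]]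
    by (simp add: eq)
qed

lemma total_recursive_on_prod_encode:
  assumes "total_recursive_on k a" and "total_recursive_on k b"
  shows "total_recursive_on k (\<lambda>p xs. prod_encode (a p xs, b p xs))"
  using assms
  by (simp add: prod_encode_def total_recursive_on_add total_recursive_on_triangle)

lemma mono_triangle: "m \<le> n \<Longrightarrow> triangle m \<le> triangle n"
  by (induction rule: dec_induct) auto

text \<open>
  Decoding inverts \<open>triangle (i + j) + i\<close>: the diagonal \<open>i + j\<close> is found by unbounded search, where
  the condition \<open>m < triangle (Suc s)\<close> is expressed by the vanishing of
  \<open>Suc m - triangle (Suc s)\<close>.
\<close>

definition diagonal :: "nat \<Rightarrow> nat" where
  "diagonal m = (LEAST s. Suc m - triangle (Suc s) = 0)"

lemma diagonal_prod_encode: "diagonal (prod_encode (i, j)) = i + j"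
  unfolding diagonal_def
proof (rule Least_equality)
  show "Suc (prod_encode (i, j)) - triangle (Suc (i + j)) = 0"
    by (simp add: prod_encode_def)
next
  fix s assume s: "Suc (prod_encode (i, j)) - triangle (Suc s) = 0"
  show "i + j \<le> s"
  proof (rule ccontr)
    assume "\<not> i + j \<le> s"
    then have "triangle (Suc s) \<le> triangle (i + j)" by (intro mono_triangle) simp
    with s show False by (simp add: prod_encode_def)
  qed
qed

lemma total_recursive_on_diagonal:
  assumes "total_recursive_on k a"
  shows "total_recursive_on k (\<lambda>p xs. diagonal (a p xs))"
proof -
  have minimize_total: "minimize (\<lambda>y. Some (h y)) = Some (LEAST y. h y = 0)"
    if ex: "\<exists>y. h y = 0" for h :: "nat \<Rightarrow> nat"
  proof -
    have "\<forall>z < (LEAST y. h y = 0). \<exists>v. h z = Suc v"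
      using not_less_Least not0_implies_Suc by blast
    moreover have "h (LEAST y. h y = 0) = 0"
      using ex by (rule LeastI_ex)
    ultimately show ?thesis
      unfolding minimize_def by auto
  qed
  have ex: "\<exists>s. Suc m - triangle (Suc s) = 0" for m
    by (rule exI[of _ m]) simp
  have "total_recursive_on 2 (\<lambda>p ys. Suc (ys ! 1) - triangle (Suc (ys ! 0)))"
    by (intro total_recursive_on_diff total_recursive_on_Suc total_recursive_on_triangle
        total_recursive_on_nth) simp_all
  then have "total_recursive_on 1 (\<lambda>p xs. diagonal (xs ! 0))"
    using recursive_on_mu[of 1 "\<lambda>p ys. Some (Suc (ys ! 1) - triangle (Suc (ys ! 0)))"]
      minimize_total[OF ex]
    by (simp add: diagonal_def numeral_2_eq_2 del: triangle_Suc)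
  from recursive_on_comp1[OF this assms] show ?thesis by simp
qed

lemma prod_decode_diagonal:
  "fst (prod_decode m) = m - triangle (diagonal m)"
  "snd (prod_decode m) = diagonal m - (m - triangle (diagonal m))"
proof -
  obtain i j where "m = prod_encode (i, j)"
    by (metis prod_decode_inverse surj_pair)
  then show "fst (prod_decode m) = m - triangle (diagonal m)"
    "snd (prod_decode m) = diagonal m - (m - triangle (diagonal m))"
    by (simp_all add: diagonal_prod_encode) (simp_all add: prod_encode_def)
qed

lemma total_recursive_on_prod_decode:
  assumes "total_recursive_on k a"
  shows "total_recursive_on k (\<lambda>p xs. fst (prod_decode (a p xs)))"
    and "total_recursive_on k (\<lambda>p xs. snd (prod_decode (a p xs)))"
  unfolding prod_decode_diagonal
  by (intro total_recursive_on_diff total_recursive_on_triangle total_recursive_on_diagonal assms)+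

lemmas total_recursive_on_intros =
  total_recursive_on_nth total_recursive_on_const total_recursive_on_Suc total_recursive_on_add
  total_recursive_on_mod2 total_recursive_on_div2
  total_recursive_on_prod_encode total_recursive_on_prod_decode

section \<open>Computability of reindexing and of componentwise application\<close>

text \<open>
  The parameter is the last entry of the tuple because primitive recursion and unbounded search act
  on the front of the tuple and so pass a last entry on unchanged.
\<close>

lemma recursive_on_parameterized_oracle:
  assumes "recursive_in k \<Phi>" and g: "total_recursive_on 2 (\<lambda>p xs. g (xs ! 0) (xs ! 1))"
  shows "recursive_on (Suc k) (\<lambda>p ys. \<Phi> (\<lambda>x. p (g (last ys) x)) (butlast ys))"
  using assms(1)
proof (induction rule: recursive_in.induct)
  case (zero k)
  show ?case by (rule total_recursive_on_const)
next
  case succ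
  have "total_recursive_on (Suc 1) (\<lambda>p ys. Suc (ys ! 0))"
    by (intro total_recursive_on_intros) simp
  then show ?case
    by (rule recursive_on_cong) (auto simp: length_Suc_conv)
next
  case (proj i k)
  then have "total_recursive_on (Suc k) (\<lambda>p ys. ys ! i)"
    by (intro total_recursive_on_intros) simp
  then show ?case
    by (rule recursive_on_cong) (use proj in \<open>simp add: nth_butlast\<close>)
next
  case query
  have "total_recursive_on 2 (\<lambda>p ys. g (ys ! 1) (ys ! 0))"
    using recursive_on_comp2[OF g, of 2 "\<lambda>p ys. ys ! 1" "\<lambda>p ys. ys ! 0"]
    by (simp add: total_recursive_on_nth)
  then have "total_recursive_on 2 (\<lambda>p ys. p (g (ys ! 1) (ys ! 0)))"
    by (rule total_recursive_on_query)
  then show ?case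
    unfolding numeral_2_eq_2 One_nat_def
    by (rule recursive_on_cong) (auto simp: length_Suc_conv)
next
  case (comp \<Psi>s \<Phi> k)
  let ?q = "\<lambda>p ys x. p (g (last ys) x)"
  let ?\<Psi>s = "map (\<lambda>\<Psi> p ys. \<Psi> (?q p ys) (butlast ys)) \<Psi>s @ [\<lambda>p ys. Some (ys ! k)]"
  have "recursive_on (Suc k) (\<lambda>p ys. Option.bind (those (map (\<lambda>\<Psi>. \<Psi> p ys) ?\<Psi>s))
      ((\<lambda>p zs. \<Phi> (?q p zs) (butlast zs)) p))"
    using comp total_recursive_on_nth[of k "Suc k"]
    by (intro recursive_on_comp[of ?\<Psi>s "\<lambda>p zs. \<Phi> (?q p zs) (butlast zs)"]) auto
  then show ?case
  proof (rule recursive_on_cong)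
    fix p and ys :: "nat list" assume "length ys = Suc k"
    then have "ys ! k = last ys"
      by (metis diff_Suc_1 last_conv_nth list.size(3) nat.distinct(1))
    then show "Option.bind (those (map (\<lambda>\<Psi>. \<Psi> p ys) ?\<Psi>s))
        (\<lambda>zs. \<Phi> (?q p zs) (butlast zs)) =
      Option.bind (those (map (\<lambda>\<Psi>. \<Psi> (?q p ys) (butlast ys)) \<Psi>s)) (\<Phi> (?q p ys))"
      by (cases "those (map (\<lambda>\<Psi>. \<Psi> (?q p ys) (butlast ys)) \<Psi>s)")
        (simp_all add: those_snoc_Some comp_def)
  qed
next
  case (prim k \<Phi> \<Psi>)
  let ?q = "\<lambda>p ys x. p (g (last ys) x)"
  have "recursive_on (Suc k + 1) (\<lambda>p ys.
      rec_nat ((\<lambda>p ys. \<Phi> (?q p ys) (butlast ys)) p (tl ys))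
      (\<lambda>n r. Option.bind r (\<lambda>y. (\<lambda>p ys. \<Psi> (?q p ys) (butlast ys)) p (n # y # tl ys))) (hd ys))"
    using prim.IH
    by (intro recursive_on_prim[of "Suc k" "\<lambda>p ys. \<Phi> (?q p ys) (butlast ys)"
        "\<lambda>p ys. \<Psi> (?q p ys) (butlast ys)"]) simp_all
  then show ?case
    unfolding Suc_eq_plus1
  proof (rule recursive_on_cong)
    fix p and ys :: "nat list" assume "length ys = k + 1 + 1"
    then obtain y z zs where "ys = y # z # zs"
      by (auto simp: length_Suc_conv)
    then show "rec_nat (\<Phi> (?q p (tl ys)) (butlast (tl ys)))
        (\<lambda>n r. Option.bind r
          (\<lambda>y. \<Psi> (?q p (n # y # tl ys)) (butlast (n # y # tl ys)))) (hd ys) =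
      rec_nat (\<Phi> (?q p ys) (tl (butlast ys)))
        (\<lambda>n r. Option.bind r (\<lambda>y. \<Psi> (?q p ys) (n # y # tl (butlast ys)))) (hd (butlast ys))"
      by simp
  qed
next
  case (mu k \<Phi>)
  let ?q = "\<lambda>p ys x. p (g (last ys) x)"
  have "recursive_on (Suc k)
      (\<lambda>p ys. minimize (\<lambda>y. (\<lambda>p ys. \<Phi> (?q p ys) (butlast ys)) p (y # ys)))"
    using mu.IH
    by (intro recursive_on_mu[of "Suc k" "\<lambda>p ys. \<Phi> (?q p ys) (butlast ys)"]) simp
  then show ?case
  proof (rule recursive_on_cong)
    fix p and ys :: "nat list" assume "length ys = Suc k"
    then have "ys \<noteq> []" by auto
    then show "minimize (\<lambda>y. \<Phi> (?q p (y # ys)) (butlast (y # ys))) =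
        minimize (\<lambda>y. \<Phi> (?q p ys) (y # butlast ys))"
      by simp
  qed
qed

lemma computableI:
  assumes "recursive_on 1 \<Phi>" and "\<And>p q n. F p = Some q \<Longrightarrow> \<Phi> p [n] = Some (q n)"
  shows "computable F"
proof -
  obtain \<Phi>' where "recursive_in 1 \<Phi>'" "\<And>p n. \<Phi>' p [n] = \<Phi> p [n]"
    using assms(1) unfolding recursive_on_def by force
  then show ?thesis
    unfolding computable_def using assms(2) by metis
qed

lemma computable_reindex:
  assumes "total_recursive_on 1 (\<lambda>p xs. g (xs ! 0))"
  shows "computable (\<lambda>p. Some (\<lambda>m. p (g m)))"
  using total_recursive_on_query[OF assms] by (rule computableI) auto

lemma computable_comp_reindex:
  assumes F: "computable F" and g: "total_recursive_on 1 (\<lambda>p xs. g (xs ! 0))"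
  shows "computable (\<lambda>p. F (\<lambda>m. p (g m)))"
proof -
  obtain \<Phi> where \<Phi>: "recursive_in 1 \<Phi>" "\<And>p q n. F p = Some q \<Longrightarrow> \<Phi> p [n] = Some (q n)"
    using F unfolding computable_def by blast
  have "total_recursive_on 2 (\<lambda>p xs. g (xs ! 1))"
    using recursive_on_comp1[OF g, of 2 "\<lambda>p xs. xs ! 1"] by (simp add: total_recursive_on_nth)
  from recursive_on_parameterized_oracle[OF \<Phi>(1) this]
  have "recursive_on 2 (\<lambda>p ys. \<Phi> (\<lambda>m. p (g m)) (butlast ys))"
    by (simp add: numeral_2_eq_2)
  from recursive_on_comp2[OF this total_recursive_on_nth[of 0] total_recursive_on_const[of _ 0]]
  have "recursive_on 1 (\<lambda>p xs. \<Phi> (\<lambda>m. p (g m)) [xs ! 0])"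
    by simp
  then show ?thesis
    by (rule computableI) (simp add: \<Phi>(2))
qed

text \<open>
  For \<open>g i x = prod_encode (i, x)\<close> this applies \<open>F\<close> to every component of \<open>p\<close>. Another \<open>g\<close> is needed
  when \<open>p\<close> is a pair of two tuples and \<open>F\<close> is to be applied to the pairs of their \<open>i\<close>-th components.
\<close>

definition componentwise ::
  "(baire \<rightharpoonup> baire) \<Rightarrow> (nat \<Rightarrow> nat \<Rightarrow> nat) \<Rightarrow> (baire \<rightharpoonup> baire)" where
  "componentwise F g p =
     (if \<forall>i. F (\<lambda>x. p (g i x)) \<noteq> None
      then Some (tuple (\<lambda>i. the (F (\<lambda>x. p (g i x))))) else None)"

lemma componentwise_eq_Some:
  assumes "\<And>i. F (\<lambda>x. p (g i x)) = Some (qs i)"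
  shows "componentwise F g p = Some (tuple qs)"
  using assms by (simp add: componentwise_def)

text \<open>
  The value at \<open>m\<close>, where \<open>m\<close> encodes \<open>(i, j)\<close>, is computed by running the algorithm for \<open>F\<close> on the
  argument \<open>j\<close>, with oracle queries \<open>x\<close> redirected to \<open>g i x\<close>.
\<close>

lemma computable_componentwise:
  assumes F: "computable F" and g: "total_recursive_on 2 (\<lambda>p xs. g (xs ! 0) (xs ! 1))"
  shows "computable (componentwise F g)"
proof -
  obtain \<Phi> where \<Phi>: "recursive_in 1 \<Phi>" "\<And>p q n. F p = Some q \<Longrightarrow> \<Phi> p [n] = Some (q n)"
    using F unfolding computable_def by blast
  have "recursive_on 2 (\<lambda>p ys. \<Phi> (\<lambda>x. p (g (last ys) x)) (butlast ys))"
    using recursive_on_parameterized_oracle[OF \<Phi>(1) g] by (simp add: numeral_2_eq_2)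
  from recursive_on_comp2[OF this, of 1 "\<lambda>p xs. snd (prod_decode (xs ! 0))"
      "\<lambda>p xs. fst (prod_decode (xs ! 0))"]
  have "recursive_on 1 (\<lambda>p xs. \<Phi> (\<lambda>x. p (g (fst (prod_decode (xs ! 0))) x))
      [snd (prod_decode (xs ! 0))])"
    by (simp add: total_recursive_on_intros)
  then show ?thesis
  proof (rule computableI)
    fix p q m assume q: "componentwise F g p = Some q"
    obtain i j where m: "prod_decode m = (i, j)" by (cases "prod_decode m")
    have "F (\<lambda>x. p (g i x)) \<noteq> None"
      using q unfolding componentwise_def by (metis option.distinct(1))
    then obtain r where r: "F (\<lambda>x. p (g i x)) = Some r" by blast
    then have "q m = r j"
      using q m by (auto simp: componentwise_def tuple_def split: if_splits)
    then show "\<Phi> (\<lambda>x. p (g (fst (prod_decode ([m] ! 0))) x)) [snd (prod_decode ([m] ! 0))] =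
        Some (q m)"
      using \<Phi>(2)[OF r] m by simp
  qed
qed

section \<open>Realizers and pointwise reductions\<close>

text \<open>
  The two reducibilities differ only in what \<open>H\<close> is given: the combination \<open>c p q\<close> of the input \<open>p\<close>
  with the answer \<open>q\<close> is \<open>pair p q\<close> in one case and \<open>q\<close> in the other.
\<close>

definition reduces_via ::
  "(baire \<Rightarrow> baire \<Rightarrow> baire) \<Rightarrow> (baire \<rightharpoonup> baire) \<Rightarrow> (baire \<rightharpoonup> baire) \<Rightarrow>
   ('a, 'b) mvfun \<Rightarrow> ('c, 'd) mvfun \<Rightarrow> bool" where
  "reduces_via c H K f g \<longleftrightarrow>
     (\<forall>G. realizer G g \<longrightarrow>
        realizer (\<lambda>p. Option.bind (Option.bind (K p) G) (\<lambda>q. H (c p q))) f)"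

lemma weihrauch_le_iff:
  "f \<le>\<^sub>W g \<longleftrightarrow> (\<exists>H K. computable H \<and> computable K \<and> reduces_via pair H K f g)"
  unfolding weihrauch_le_def reduces_via_def ..

lemma strong_weihrauch_le_iff:
  "f \<le>\<^sub>s\<^sub>W g \<longleftrightarrow> (\<exists>H K. computable H \<and> computable K \<and> reduces_via (\<lambda>p q. q) H K f g)"
  unfolding strong_weihrauch_le_def reduces_via_def by simp

lemma realizerD:
  assumes "realizer F f" and "rep (source f) p = Some x" and "x \<in> mv_dom f"
  obtains q y where "F p = Some q" "rep (target f) q = Some y" "y \<in> vals f x"
  using assms unfolding realizer_def by blast

text \<open>
  At names of points in the domain, the realizer returns a name of some chosen correct value, which
  exists since the representation of the target is surjective; elsewhere it is undefined.
\<close>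

lemma ex_minimal_realizer:
  assumes g: "multivalued_function g"
  obtains G where "realizer G g"
    and "\<And>p. G p \<noteq> None \<Longrightarrow> \<exists>x \<in> mv_dom g. rep (source g) p = Some x"
proof -
  have "\<exists>q y. rep (target g) q = Some y \<and> y \<in> vals g x" if x: "x \<in> mv_dom g" for x
  proof -
    obtain y where "y \<in> vals g x" "x \<in> points (source g)"
      using x unfolding mv_dom_def by auto
    then have "y \<in> ran (rep (target g))"
      using g unfolding multivalued_function_def represented_space_def by blast
    with \<open>y \<in> vals g x\<close> show ?thesis unfolding ran_def by blast
  qed
  then obtain Q where Q: "\<And>x. x \<in> mv_dom g \<Longrightarrow> \<exists>y. rep (target g) (Q x) = Some y \<and> y \<in> vals g x"
    by metis
  let ?G = "\<lambda>p. case rep (source g) p of None \<Rightarrow> None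
      | Some x \<Rightarrow> if x \<in> mv_dom g then Some (Q x) else None"
  have "realizer ?G g"
    using Q unfolding realizer_def by auto
  moreover have "?G p \<noteq> None \<Longrightarrow> \<exists>x \<in> mv_dom g. rep (source g) p = Some x" for p
    by (auto split: option.splits if_splits)
  ultimately show ?thesis by (rule that)
qed

lemma realizer_update:
  assumes "realizer G g" and "rep (source g) p = Some x"
    and "rep (target g) q = Some y" and "y \<in> vals g x"
  shows "realizer (G(p := Some q)) g"
  using assms unfolding realizer_def by auto

text \<open>
  Testing a reduction on a realizer with the smallest possible domain shows that \<open>K\<close> turns
  names of points in the domain of \<open>f\<close> into names of points in the domain of \<open>g\<close>. Changing this
  realizer at the single name \<open>s\<close> to an arbitrary correct answer \<open>r\<close> shows that \<open>H\<close> can deal with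
  \<open>r\<close>.
\<close>

lemma reduces_via_pointwise:
  assumes red: "reduces_via c H K f g" and g: "multivalued_function g"
    and p: "rep (source f) p = Some x" "x \<in> mv_dom f"
  obtains s u where "K p = Some s" "rep (source g) s = Some u" "u \<in> mv_dom g"
    and "\<And>r v. rep (target g) r = Some v \<Longrightarrow> v \<in> vals g u \<Longrightarrow>
           \<exists>q y. H (c p r) = Some q \<and> rep (target f) q = Some y \<and> y \<in> vals f x"
proof -
  have run: "\<exists>q y. Option.bind (Option.bind (K p) G) (\<lambda>q. H (c p q)) = Some q \<and>
      rep (target f) q = Some y \<and> y \<in> vals f x" if "realizer G g" for G
    using red that p unfolding reduces_via_def by (blast elim: realizerD)
  obtain G where G: "realizer G g"
    "\<And>p. G p \<noteq> None \<Longrightarrow> \<exists>x \<in> mv_dom g. rep (source g) p = Some x"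
    using ex_minimal_realizer[OF g] by blast
  obtain s where s: "K p = Some s" "G s \<noteq> None"
    using run[OF G(1)] by (cases "K p") (auto simp: bind_eq_Some_conv)
  then obtain u where u: "rep (source g) s = Some u" "u \<in> mv_dom g"
    using G(2) by blast
  have "\<exists>q y. H (c p r) = Some q \<and> rep (target f) q = Some y \<and> y \<in> vals f x"
    if "rep (target g) r = Some v" "v \<in> vals g u" for r v
    using run[OF realizer_update[OF G(1) u(1) that]] s(1) by simp
  with s(1) u show ?thesis by (rule that)
qed

section \<open>Properties of parallelization\<close>

lemma parallelization_simps [simp]:
  "source (parallelization f) = seq_space (source f)"
  "target (parallelization f) = seq_space (target f)"
  "vals (parallelization f) x = {y. \<forall>i. y i \<in> vals f (x i)}"
  by (simp_all add: parallelization_def)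

lemma strong_weihrauch_le_imp_weihrauch_le:
  assumes "f \<le>\<^sub>s\<^sub>W g"
  shows "f \<le>\<^sub>W g"
proof -
  obtain H K where HK: "computable H" "computable K" "reduces_via (\<lambda>p q. q) H K f g"
    using assms unfolding strong_weihrauch_le_iff by blast
  \<comment> \<open>The odd positions of \<open>pair p q\<close> hold \<open>q\<close>.\<close>
  let ?H = "\<lambda>z. H (\<lambda>x. z (Suc (x + x)))"
  have "(\<lambda>x. pair p q (Suc (x + x))) = q" for p q
    by (rule ext) (simp add: pair_def flip: mult_2)
  then have "reduces_via pair ?H K f g"
    using HK(3) unfolding reduces_via_def by simp
  moreover have "computable ?H"
    by (rule computable_comp_reindex[OF HK(1)]) (simp add: total_recursive_on_intros)
  ultimately show ?thesis
    unfolding weihrauch_le_iff using HK(2) by blast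
qed

lemma strong_weihrauch_le_reindexI:
  assumes h: "total_recursive_on 1 (\<lambda>p xs. h (xs ! 0))"
    and k: "total_recursive_on 1 (\<lambda>p xs. k (xs ! 0))"
    and K: "\<And>p x. rep (source f) p = Some x \<Longrightarrow> x \<in> mv_dom f \<Longrightarrow>
      \<exists>u. rep (source g) (\<lambda>m. p (k m)) = Some u \<and> u \<in> mv_dom g \<and>
        (\<forall>r v. rep (target g) r = Some v \<longrightarrow> v \<in> vals g u \<longrightarrow>
          (\<exists>y. rep (target f) (\<lambda>m. r (h m)) = Some y \<and> y \<in> vals f x))"
  shows "f \<le>\<^sub>s\<^sub>W g"
proof -
  let ?H = "\<lambda>p. Some (\<lambda>m. p (h m))" and ?K = "\<lambda>p. Some (\<lambda>m. p (k m))"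
  have "reduces_via (\<lambda>p q. q) ?H ?K f g"
    unfolding reduces_via_def realizer_def[of _ f]
  proof (intro allI impI, elim conjE)
    fix G p x
    assume G: "realizer G g" and p: "rep (source f) p = Some x" "x \<in> mv_dom f"
    obtain u where u: "rep (source g) (\<lambda>m. p (k m)) = Some u" "u \<in> mv_dom g"
      "\<And>r v. rep (target g) r = Some v \<Longrightarrow> v \<in> vals g u \<Longrightarrow>
          \<exists>y. rep (target f) (\<lambda>m. r (h m)) = Some y \<and> y \<in> vals f x"
      using K[OF p] by blast
    obtain r v where "G (\<lambda>m. p (k m)) = Some r" "rep (target g) r = Some v" "v \<in> vals g u"
      using realizerD[OF G u(1,2)] .
    with u(3) show "\<exists>q y. Option.bind (Option.bind (?K p) G) ?H = Some q \<and>
        rep (target f) q = Some y \<and> y \<in> vals f x"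
      by fastforce
  qed
  then show ?thesis
    unfolding strong_weihrauch_le_iff using computable_reindex[OF h] computable_reindex[OF k] by blast
qed

text \<open>The input is repeated infinitely often, and the first component of the answer is kept.\<close>

lemma strong_weihrauch_le_parallelization: "f \<le>\<^sub>s\<^sub>W parallelization f"
proof (rule strong_weihrauch_le_reindexI)
  show "total_recursive_on 1 (\<lambda>p xs. prod_encode (0, xs ! 0))"
    and "total_recursive_on 1 (\<lambda>p xs. snd (prod_decode (xs ! 0)))"
    by (simp_all add: total_recursive_on_intros)
next
  fix p x assume p: "rep (source f) p = Some x" "x \<in> mv_dom f"
  have "component (\<lambda>m. p (snd (prod_decode m))) i = p" for i
    by (simp add: component_def)
  then have "rep (seq_space (source f)) (\<lambda>m. p (snd (prod_decode m))) = Some (\<lambda>i. x)"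
    using p(1) by (simp add: rep_seq_space_iff)
  moreover have "(\<lambda>i. x) \<in> mv_dom (parallelization f)"
    using p(2) by (simp add: mv_dom_parallelization)
  moreover have "\<exists>y. rep (target f) (\<lambda>m. r (prod_encode (0, m))) = Some y \<and> y \<in> vals f x"
    if "rep (seq_space (target f)) r = Some v" "\<forall>i::nat. v i \<in> vals f x" for r v
    using that by (auto simp: rep_seq_space_iff component_def)
  ultimately show "\<exists>u. rep (source (parallelization f)) (\<lambda>m. p (snd (prod_decode m))) = Some u \<and>
      u \<in> mv_dom (parallelization f) \<and>
      (\<forall>r v. rep (target (parallelization f)) r = Some v \<longrightarrow> v \<in> vals (parallelization f) u \<longrightarrow>
        (\<exists>y. rep (target f) (\<lambda>m. r (prod_encode (0, m))) = Some y \<and> y \<in> vals f x))"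
    by auto
qed

text \<open>
  A double sequence is read as a single sequence by \<^const>\<open>prod_encode\<close> and the answer is
  regrouped accordingly.
\<close>

lemma strong_weihrauch_parallelization_twice_le:
  "parallelization (parallelization f) \<le>\<^sub>s\<^sub>W parallelization f"
proof -
  \<comment> \<open>On indices, regrouping turns \<open>(n, l)\<close> with \<open>n\<close> encoding \<open>(i, j)\<close> into \<open>(i, (j, l))\<close>;
    \<open>h\<close> goes in the opposite direction.\<close>
  define k where "k m = (let n = fst (prod_decode m) in
    prod_encode (fst (prod_decode n), prod_encode (snd (prod_decode n), snd (prod_decode m))))"
    for m
  define h where "h m = (let n = snd (prod_decode m) in
    prod_encode (prod_encode (fst (prod_decode m), fst (prod_decode n)), snd (prod_decode n)))"
    for m
  show ?thesis
  proof (rule strong_weihrauch_le_reindexI)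
    show "total_recursive_on 1 (\<lambda>p xs. h (xs ! 0))" "total_recursive_on 1 (\<lambda>p xs. k (xs ! 0))"
      unfolding h_def k_def Let_def by (simp_all add: total_recursive_on_intros)
  next
    fix p x
    assume p: "rep (source (parallelization (parallelization f))) p = Some x"
      "x \<in> mv_dom (parallelization (parallelization f))"
    let ?u = "\<lambda>n. x (fst (prod_decode n)) (snd (prod_decode n))"
    have "component (\<lambda>m. p (k m)) n =
        component (component p (fst (prod_decode n))) (snd (prod_decode n))" for n
      by (simp add: component_def k_def Let_def)
    then have "rep (seq_space (source f)) (\<lambda>m. p (k m)) = Some ?u"
      using p(1) by (simp add: rep_seq_space_iff)
    moreover have "?u \<in> mv_dom (parallelization f)"
      using p(2) by (simp add: mv_dom_parallelization)
    moreover have "\<exists>y. rep (seq_space (seq_space (target f))) (\<lambda>m. r (h m)) = Some y \<and>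
        (\<forall>i j. y i j \<in> vals f (x i j))"
      if r: "rep (seq_space (target f)) r = Some v" and v: "\<forall>n. v n \<in> vals f (?u n)" for r v
    proof (intro exI conjI)
      have "component (component (\<lambda>m. r (h m)) i) j = component r (prod_encode (i, j))" for i j
        by (simp add: component_def h_def Let_def)
      then show "rep (seq_space (seq_space (target f))) (\<lambda>m. r (h m)) =
          Some (\<lambda>i j. v (prod_encode (i, j)))"
        using r by (simp add: rep_seq_space_iff)
      show "\<forall>i j. v (prod_encode (i, j)) \<in> vals f (x i j)"
        by (metis fst_conv prod_encode_inverse snd_conv v)
    qed
    ultimately show "\<exists>u. rep (source (parallelization f)) (\<lambda>m. p (k m)) = Some u \<and>
        u \<in> mv_dom (parallelization f) \<and>
        (\<forall>r v. rep (target (parallelization f)) r = Some v \<longrightarrow> v \<in> vals (parallelization f) u \<longrightarrow>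
          (\<exists>y. rep (target (parallelization (parallelization f))) (\<lambda>m. r (h m)) = Some y \<and>
            y \<in> vals (parallelization (parallelization f)) x))"
      by auto
  qed
qed

text \<open>
  In component \<open>i\<close>, the outer map has to run \<open>H\<close> on \<open>c (component p i) (component r i)\<close>, but it is
  given only \<open>c p r\<close>. The hypothesis on \<open>c\<close> ensures that it can answer the queries of \<open>H\<close>.
\<close>

lemma reduces_via_parallelization:
  assumes red: "reduces_via c H K f g" and g: "multivalued_function g"
    and c: "\<And>p r i. c (component p i) (component r i) = (\<lambda>x. c p r (e i x))"
  shows "reduces_via c (componentwise H e) (componentwise K (\<lambda>i x. prod_encode (i, x)))
    (parallelization f) (parallelization g)"
  unfolding reduces_via_def realizer_def[of _ "parallelization f"]
proof (intro allI impI, elim conjE)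
  let ?H = "componentwise H e" and ?K = "componentwise K (\<lambda>i x. prod_encode (i, x))"
  fix G p x
  assume G: "realizer G (parallelization g)"
    and p: "rep (source (parallelization f)) p = Some x" "x \<in> mv_dom (parallelization f)"
  have "\<exists>s u. K (component p i) = Some s \<and> rep (source g) s = Some u \<and> u \<in> mv_dom g \<and>
      (\<forall>r v. rep (target g) r = Some v \<longrightarrow> v \<in> vals g u \<longrightarrow>
        (\<exists>q y. H (c (component p i) r) = Some q \<and> rep (target f) q = Some y \<and>
          y \<in> vals f (x i)))" for i
    using p reduces_via_pointwise[OF red g, of "component p i" "x i"]
    by (simp add: rep_seq_space_iff mv_dom_parallelization) metis
  then obtain s u where su: "\<And>i. K (component p i) = Some (s i)"
    "\<And>i. rep (source g) (s i) = Some (u i)" "\<And>i. u i \<in> mv_dom g"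
    and ans: "\<And>i r v. rep (target g) r = Some v \<Longrightarrow> v \<in> vals g (u i) \<Longrightarrow>
      \<exists>q y. H (c (component p i) r) = Some q \<and> rep (target f) q = Some y \<and> y \<in> vals f (x i)"
    by metis
  have K: "?K p = Some (tuple s)"
    by (rule componentwise_eq_Some) (use su(1) in \<open>simp add: component_def\<close>)
  have "rep (source (parallelization g)) (tuple s) = Some u" "u \<in> mv_dom (parallelization g)"
    using su(2,3) by (simp_all add: rep_seq_space_tuple mv_dom_parallelization)
  then obtain r v where r: "G (tuple s) = Some r" "rep (seq_space (target g)) r = Some v"
      "\<And>i. v i \<in> vals g (u i)"
    using realizerD[OF G] by (metis (mono_tags, lifting) mem_Collect_eq parallelization_simps(2,3))
  have "\<exists>q y. H (c (component p i) (component r i)) = Some q \<and> rep (target f) q = Some y \<and>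
      y \<in> vals f (x i)" for i
    using ans r(2,3) by (simp add: rep_seq_space_iff)
  then obtain q y where q: "\<And>i. H (c (component p i) (component r i)) = Some (q i)"
    "\<And>i. rep (target f) (q i) = Some (y i)" "\<And>i. y i \<in> vals f (x i)"
    by metis
  have "?H (c p r) = Some (tuple q)"
    by (rule componentwise_eq_Some) (use q(1) in \<open>simp add: c\<close>)
  moreover have "rep (target (parallelization f)) (tuple q) = Some y"
    using q(2) by (simp add: rep_seq_space_tuple)
  ultimately show "\<exists>q y. Option.bind (Option.bind (?K p) G) (\<lambda>q. ?H (c p q)) = Some q \<and>
      rep (target (parallelization f)) q = Some y \<and> y \<in> vals (parallelization f) x"
    using K r(1) q(3) by auto
qed

lemma strong_weihrauch_le_parallelization_mono:
  assumes "f \<le>\<^sub>s\<^sub>W g" and g: "multivalued_function g"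
  shows "parallelization f \<le>\<^sub>s\<^sub>W parallelization g"
proof -
  obtain H K where HK: "computable H" "computable K" "reduces_via (\<lambda>p q. q) H K f g"
    using assms(1) unfolding strong_weihrauch_le_iff by blast
  have enc: "total_recursive_on 2 (\<lambda>p xs. prod_encode (xs ! 0, xs ! 1))"
    by (simp add: total_recursive_on_intros)
  show ?thesis
    unfolding strong_weihrauch_le_iff
    using computable_componentwise[OF HK(1) enc] computable_componentwise[OF HK(2) enc]
      reduces_via_parallelization[OF HK(3) g, of "\<lambda>i x. prod_encode (i, x)"]
    by (auto simp: component_def)
qed

lemma weihrauch_le_parallelization_mono:
  assumes "f \<le>\<^sub>W g" and g: "multivalued_function g"
  shows "parallelization f \<le>\<^sub>W parallelization g"
proof -
  obtain H K where HK: "computable H" "computable K" "reduces_via pair H K f g"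
    using assms(1) unfolding weihrauch_le_iff by blast
  have enc: "total_recursive_on 2 (\<lambda>p xs. prod_encode (xs ! 0, xs ! 1))"
    by (simp add: total_recursive_on_intros)
  \<comment> \<open>Position \<open>x\<close> of a pair of \<open>i\<close>-th components belongs to the first or the second of them
    according to the parity of \<open>x\<close>, and is position \<open>x div 2\<close> there.\<close>
  define e where "e i x = prod_encode (i, x div 2) + prod_encode (i, x div 2) + x mod 2" for i x
  have "total_recursive_on 2 (\<lambda>p xs. e (xs ! 0) (xs ! 1))"
    unfolding e_def by (simp add: total_recursive_on_intros)
  moreover have "pair (component p i) (component r i) = (\<lambda>x. pair p r (e i x))" for p r i
  proof
    fix x
    show "pair (component p i) (component r i) x = pair p r (e i x)"
      by (cases "even x") (simp_all add: pair_def component_def e_def odd_iff_mod_2_eq_one[THEN iffD1]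
          flip: mult_2)
  qed
  ultimately show ?thesis
    unfolding weihrauch_le_iff
    using computable_componentwise[OF HK(1)] computable_componentwise[OF HK(2) enc]
      reduces_via_parallelization[OF HK(3) g] by blast
qed

theorem proposition4p2:
  fixes f :: "('a, 'b) mvfun" and g :: "('c, 'd) mvfun"
  assumes "multivalued_function f" and "multivalued_function g"
  shows
    "f \<le>\<^sub>W parallelization f \<and>
     (f \<le>\<^sub>W g \<longrightarrow> parallelization f \<le>\<^sub>W parallelization g) \<and>
     parallelization f \<equiv>\<^sub>W parallelization (parallelization f) \<and>
     f \<le>\<^sub>s\<^sub>W parallelization f \<and>
     (f \<le>\<^sub>s\<^sub>W g \<longrightarrow> parallelization f \<le>\<^sub>s\<^sub>W parallelization g) \<and>
     parallelization f \<equiv>\<^sub>s\<^sub>W parallelization (parallelization f)"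
  unfolding weihrauch_equiv_def strong_weihrauch_equiv_def
  by (intro conjI impI strong_weihrauch_le_imp_weihrauch_le[OF strong_weihrauch_le_parallelization]
      strong_weihrauch_le_imp_weihrauch_le[OF strong_weihrauch_parallelization_twice_le]
      strong_weihrauch_le_parallelization strong_weihrauch_parallelization_twice_le
      weihrauch_le_parallelization_mono[OF _ assms(2)]
      strong_weihrauch_le_parallelization_mono[OF _ assms(2)])

end
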